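(* For any fixed integer $l \ge 1$, $$E(d(l, k)) \sim 2 (k-1)^{l-1/2} \qquad \text{as } k \to \infty .$$ Also, for any fixed integer $k \ge 3$, $$E(d(l, k)) \sim \mu_k (k-1)^{l-1/2} \qquad \text{as } l \to \infty ,$$ where $\mu_k$ is the positive real number which is the sum of the convergent positive series $$\sum_{j = 0}^{\infty} f_j (k-1)^{-j}$$ defined by $$f_j = \begin{cases} 2 \csc\left( \dfrac{\pi}{2j+6} \right) - 2\csc\left( \dfrac{\pi}{2j+2} \right), & j \text{ even},\\ 2 \cot\left( \dfrac{\pi}{2j+6} \right) - 2\cot\left( \dfrac{\pi}{2j+2} \right), & j \text{ odd}. \end{cases}$$
   Context: For a finite simple graph $G$ with adjacency matrix $A(G)$ having eigenvalues $\lambda_1,\dots,\lambda_n$ (with multiplicity), the energy is $E(G)=\sum_{j=1}^n|\lambda_j|$. For integers $l\ge 1$ and $k\ge 2$, the dendrimer $d(l,k)$ is the rooted tree with $l+1$ levels numbered $0,\dots,l$ (level $0$ consists of the root, level $l$ consists of the leaves) in which every vertex in levels $0,\dots,l-1$ (the internal vertices) has degree $k$; i.e. the root has $k$ children, every vertex in levels $1,\dots,l-1$ has $k-1$ children, and vertices in level $l$ have no children. The notation $g\sim h$ means $g/h\to 1$; $k$ and $l$ range over integers. *)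

theory Defs
  imports
    "HOL-Analysis.Analysis"
    "HOL-Library.Landau_Symbols"
    "Jordan_Normal_Form.Char_Poly"
    "Graph_Theory.Pair_Digraph"
begin

text \<open>
  A finite simple graph is a \<^locale>\<open>pair_graph\<close>: each undirected edge is represented by its two arcs.
\<close>

definition adjacency_mat :: "'a pair_pre_digraph \<Rightarrow> 'a list \<Rightarrow> complex mat" where
  "adjacency_mat G vs =
     mat (length vs) (length vs) (\<lambda>(i, j). if (vs ! i, vs ! j) \<in> parcs G then 1 else 0)"

text \<open>
  The vertices are enumerated by an arbitrary duplicate-free list; another choice conjugates the
  matrix by a permutation matrix and so leaves the characteristic polynomial unchanged.
  The multiset of roots is taken over the complex numbers, so that it always has as many elements
  as the graph has vertices.
\<close>

definition graph_energy :: "'a pair_pre_digraph \<Rightarrow> real" where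
  "graph_energy G =
     (let vs = (SOME vs. distinct vs \<and> set vs = pverts G)
      in \<Sum>z\<in>#proots (char_poly (adjacency_mat G vs)). cmod z)"

text \<open>
  A vertex of the dendrimer is the list of child indices on the path leading to it from the root
  \<^term>\<open>[]\<close>; its level is the length of that list.
\<close>

definition dendrimer_verts :: "nat \<Rightarrow> nat \<Rightarrow> nat list set" where
  "dendrimer_verts l k =
     {v. length v \<le> l \<and> (\<forall>i < length v. v ! i < (if i = 0 then k else k - 1))}"

definition dendrimer :: "nat \<Rightarrow> nat \<Rightarrow> nat list pair_pre_digraph" where
  "dendrimer l k =
     \<lparr> pverts = dendrimer_verts l k,
       parcs = {(u, v). u \<in> dendrimer_verts l k \<and> v \<in> dendrimer_verts l k \<and>
                        (\<exists>c. v = u @ [c] \<or> u = v @ [c])} \<rparr>"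

lemma finite_dendrimer_verts: "finite (dendrimer_verts l k)"
proof (rule finite_subset)
  show "dendrimer_verts l k \<subseteq> {v. set v \<subseteq> {..<k} \<and> length v \<le> l}"
    by (fastforce simp: dendrimer_verts_def in_set_conv_nth split: if_splits)
qed (simp add: finite_lists_length_le)

lemma pair_graph_dendrimer: "pair_graph (dendrimer l k)"
proof
  show "finite (parcs (dendrimer l k))"
    by (rule finite_subset[of _ "dendrimer_verts l k \<times> dendrimer_verts l k"])
      (auto simp: dendrimer_def finite_dendrimer_verts)
  show "symmetric (with_proj (dendrimer l k))"
    by (auto simp: symmetric_def dendrimer_def intro!: symI)
qed (auto simp: dendrimer_def finite_dendrimer_verts)

lemma degree_dendrimer_internal:
  assumes "k \<ge> 1" "v \<in> dendrimer_verts l k" "length v < l"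
  shows "card {w. (v, w) \<in> parcs (dendrimer l k)} = k"
proof -
  let ?m = "if v = [] then k else k - 1"
  have eq: "{w. (v, w) \<in> parcs (dendrimer l k)} =
        (\<lambda>c. v @ [c]) ` {..<?m} \<union> (if v = [] then {} else {butlast v})"
  proof (rule Set.set_eqI)
    fix w
    have A: "v @ [c] \<in> dendrimer_verts l k \<longleftrightarrow> c < ?m" for c
      using assms by (auto simp: dendrimer_verts_def nth_append less_Suc_eq)
    have B: "butlast v \<in> dendrimer_verts l k"
      using assms by (auto simp: dendrimer_verts_def nth_butlast)
    have C: "(\<exists>c. v = w @ [c]) \<longleftrightarrow> v \<noteq> [] \<and> w = butlast v"
      by (cases v rule: rev_cases) auto
    have "(v, w) \<in> parcs (dendrimer l k) \<longleftrightarrow>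
        w \<in> dendrimer_verts l k \<and> ((\<exists>c. w = v @ [c]) \<or> v \<noteq> [] \<and> w = butlast v)"
      using assms(2) by (simp add: dendrimer_def ex_disj_distrib C)
    also have "\<dots> \<longleftrightarrow> (\<exists>c<?m. w = v @ [c]) \<or> v \<noteq> [] \<and> w = butlast v"
      using A B by blast
    finally show "w \<in> {w. (v, w) \<in> parcs (dendrimer l k)} \<longleftrightarrow>
        w \<in> (\<lambda>c. v @ [c]) ` {..<?m} \<union> (if v = [] then {} else {butlast v})"
      by (simp add: image_iff Bex_def)
  qed
  have c: "card ((\<lambda>c. v @ [c]) ` {..<?m}) = ?m"
    by (subst card_image) (auto simp: inj_on_def)
  have "butlast v \<notin> (\<lambda>c. v @ [c]) ` {..<?m}"
  proof
    assume "butlast v \<in> (\<lambda>c. v @ [c]) ` {..<?m}"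
    then obtain c where "butlast v = v @ [c]" by auto
    then have "length (butlast v) = length (v @ [c])" by (rule arg_cong)
    then show False by simp
  qed
  then show ?thesis unfolding eq using c assms(1) by (auto simp: card_insert_if)
qed

definition csc :: "real \<Rightarrow> real" where
  "csc x = 1 / sin x"

definition energy_coeff :: "nat \<Rightarrow> real" where
  "energy_coeff j =
     (if even j
      then 2 * csc (pi / (2 * real j + 6)) - 2 * csc (pi / (2 * real j + 2))
      else 2 * cot (pi / (2 * real j + 6)) - 2 * cot (pi / (2 * real j + 2)))"

definition energy_const :: "nat \<Rightarrow> real" where
  "energy_const k = (\<Sum>j. energy_coeff j * (real k - 1) powi (- int j))"

end

theory Submission
  imports Defs "HOL-Real_Asymp.Real_Asymp"
begin

text \<open>
  Write \<open>m = k - 1\<close>, and let \<open>Q\<^sub>n\<close> be the polynomials with \<open>Q\<^sub>0 = 1\<close>, \<open>Q\<^sub>1 = x\<close> and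
  \<open>Q\<^bsub>n+2\<^esub> = x Q\<^bsub>n+1\<^esub> - m Q\<^sub>n\<close>; the roots of \<open>Q\<^sub>n\<close> are \<open>2 \<surd>m cos (\<pi> j / (n + 1))\<close>, so its
  energy is \<open>\<surd>m\<close> times the energy \<open>e\<^sub>n\<close> of a path with \<open>n\<close> vertices. Eliminating the vertices of the
  dendrimer from the leaves upwards factors \<open>x I - A\<close> as (lower) (diagonal) (upper), with pivot
  \<open>Q\<^bsub>h+1\<^esub> / Q\<^sub>h\<close> at each vertex of height \<open>h < l\<close> and pivot \<open>(Q\<^bsub>l+1\<^esub> - Q\<^bsub>l-1\<^esub>) / Q\<^sub>l\<close> at the root.
  Comparing root multisets gives
  \<open>E = E(Q\<^bsub>l+1\<^esub> - Q\<^bsub>l-1\<^esub>) - \<surd>m e\<^sub>l + k \<surd>m (\<Sum>h<l. m\<^bsup>l-1-h\<^esup> (e\<^bsub>h+1\<^esub> - e\<^sub>h))\<close>,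
  where the first term is negligible because all its \<open>l + 1\<close> roots have modulus at most \<open>k\<close>. As
  \<open>e\<^sub>0 = e\<^sub>1 = 0\<close> and \<open>e\<^sub>2 = 2\<close>, the term \<open>h = 1\<close> dominates for large \<open>k\<close>. For large \<open>l\<close> the sum becomes
  a convergent series, and \<open>f\<^sub>j = e\<^bsub>j+2\<^esub> - e\<^sub>j\<close> rearranges it into \<open>\<mu>\<^sub>k\<close>.
\<close>

section \<open>Determinants of matrices triangular with respect to a grading\<close>

text \<open>
  A nonzero Leibniz term needs \<open>f i \<le> f (p i)\<close> for all \<open>i\<close>, and the sum of \<open>f\<close> is invariant under
  \<open>p\<close>, so only \<open>p = id\<close> survives. No ordering of the rows compatible with \<open>f\<close> is needed, which is what
  the arbitrary vertex enumeration in \<^const>\<open>graph_energy\<close> requires.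
\<close>

lemma det_graded_triangular:
  fixes A :: "'a::comm_ring_1 mat" and f :: "nat \<Rightarrow> nat"
  assumes A: "A \<in> carrier_mat n n"
    and tri: "\<And>i j. i < n \<Longrightarrow> j < n \<Longrightarrow> i \<noteq> j \<Longrightarrow> A $$ (i, j) \<noteq> 0 \<Longrightarrow> f i < f j"
  shows "det A = (\<Prod>i = 0..<n. A $$ (i, i))"
proof -
  have zero: "(\<Prod>i = 0..<n. A $$ (i, p i)) = 0"
    if p: "p permutes {0..<n}" and "p \<noteq> id" for p
  proof -
    have "\<exists>i\<in>{0..<n}. A $$ (i, p i) = 0"
    proof (rule ccontr)
      assume "\<not> ?thesis"
      then have nz: "A $$ (i, p i) \<noteq> 0" if "i < n" for i using that by auto
      have pn: "p i < n" if "i < n" for i using permutes_in_image[OF p, of i] that by auto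
      have le: "f i \<le> f (p i)" if "i < n" for i
        using tri[OF that pn[OF that] _ nz[OF that]] by (cases "p i = i") auto
      obtain i where i: "p i \<noteq> i" using \<open>p \<noteq> id\<close> by (auto simp: fun_eq_iff)
      then have "i < n" using permutes_not_in[OF p, of i] by auto
      with i have "f i < f (p i)" using tri[of i "p i"] pn nz by auto
      then have "(\<Sum>i = 0..<n. f i) < (\<Sum>i = 0..<n. f (p i))"
        using le \<open>i < n\<close> by (intro sum_strict_mono_ex1) auto
      also have "\<dots> = (\<Sum>i = 0..<n. f i)"
        using sum.permute[OF p, of f] by (simp add: o_def)
      finally show False by simp
    qed
    then show ?thesis by (intro prod_zero) auto
  qed
  have "det A = (\<Sum>p \<in> {p. p permutes {0..<n}}. signof p * (\<Prod>i = 0..<n. A $$ (i, p i)))"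
    by (rule det_def'[OF A])
  also have "\<dots> = (\<Sum>p \<in> {id}. signof p * (\<Prod>i = 0..<n. A $$ (i, p i)))"
    using zero by (intro sum.mono_neutral_right) (auto simp: permutes_id finite_permutations)
  finally show ?thesis by simp
qed

section \<open>Energy of a polynomial\<close>

definition poly_energy :: "complex poly \<Rightarrow> real" where
  "poly_energy p = (\<Sum>z\<in>#proots p. cmod z)"

lemma poly_energy_1 [simp]: "poly_energy 1 = 0"
  by (simp add: poly_energy_def)

text \<open>This additivity turns a product identity between polynomials into a linear identity
  between energies.\<close>

lemma poly_energy_mult:
  "p \<noteq> 0 \<Longrightarrow> q \<noteq> 0 \<Longrightarrow> poly_energy (p * q) = poly_energy p + poly_energy q"
  by (simp add: poly_energy_def proots_mult)

lemma poly_energy_power: "p \<noteq> 0 \<Longrightarrow> poly_energy (p ^ n) = real n * poly_energy p"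
  by (induction n) (simp_all add: poly_energy_mult algebra_simps)

lemma poly_energy_prod:
  "(\<And>x. x \<in> A \<Longrightarrow> f x \<noteq> 0) \<Longrightarrow> poly_energy (\<Prod>x\<in>A. f x) = (\<Sum>x\<in>A. poly_energy (f x))"
  by (induction A rule: infinite_finite_induct) (simp_all add: poly_energy_mult)

lemma poly_energy_linear [simp]: "poly_energy [:- c, 1:] = cmod c"
  by (simp add: poly_energy_def)

lemma poly_energy_nonneg: "poly_energy p \<ge> 0"
proof -
  have "0 \<le> (\<Sum>z\<in>#M. cmod z)" for M by (induction M) auto
  then show ?thesis by (simp add: poly_energy_def)
qed

lemma poly_energy_le:
  assumes "p \<noteq> 0" and bd: "\<And>z. poly p z = 0 \<Longrightarrow> cmod z \<le> B"
  shows "poly_energy p \<le> real (degree p) * B"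
proof -
  have "poly_energy p \<le> (\<Sum>z\<in>#proots p. B)"
    unfolding poly_energy_def using assms by (intro sum_mset_mono) auto
  also have "\<dots> = real (degree p) * B"
    by (simp add: size_proots_complex)
  finally show ?thesis .
qed

section \<open>Weighted path polynomials\<close>

text \<open>The characteristic polynomial of a path whose edges all carry the weight \<open>\<surd>m\<close>.\<close>

fun path_poly :: "nat \<Rightarrow> nat \<Rightarrow> complex poly" where
  "path_poly m 0 = 1"
| "path_poly m (Suc 0) = [:0, 1:]"
| "path_poly m (Suc (Suc n)) = [:0, 1:] * path_poly m (Suc n) - Polynomial.smult (of_nat m) (path_poly m n)"

lemma degree_path_poly [simp]: "degree (path_poly m n) = n"
  and lead_coeff_path_poly: "poly.coeff (path_poly m n) n = 1"
proof -
  have "degree (path_poly m n) = n \<and> poly.coeff (path_poly m n) n = 1"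
  proof (induction m n rule: path_poly.induct)
    case (3 m n)
    then have deg: "degree (path_poly m (Suc n)) = Suc n" "degree (path_poly m n) = n"
      and lc: "poly.coeff (path_poly m (Suc n)) (Suc n) = 1" by auto
    have c: "poly.coeff (path_poly m (Suc (Suc n))) (Suc (Suc n)) = 1"
      using lc deg by (simp add: coeff_eq_0)
    have "degree (path_poly m (Suc (Suc n))) \<le> Suc (Suc n)"
    proof (rule degree_le, intro allI impI)
      fix i assume "Suc (Suc n) < i"
      then obtain j where "i = Suc j" "Suc n < j" by (cases i) auto
      then show "poly.coeff (path_poly m (Suc (Suc n))) i = 0"
        using deg by (simp add: coeff_eq_0)
    qed
    then show ?case using c by (metis le_antisym le_degree zero_neq_one)
  qed auto
  then show "degree (path_poly m n) = n" "poly.coeff (path_poly m n) n = 1" by auto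
qed

lemma path_poly_nonzero [simp]: "path_poly m n \<noteq> 0"
  using lead_coeff_path_poly[of m n] by auto

definition root_poly :: "nat \<Rightarrow> nat \<Rightarrow> complex poly" where
  "root_poly m l = path_poly m (Suc l) - path_poly m (l - 1)"

lemma degree_root_poly [simp]: "degree (root_poly m l) = Suc l"
  unfolding root_poly_def diff_conv_add_uminus
  by (subst degree_add_eq_left) auto

lemma root_poly_nonzero [simp]: "root_poly m l \<noteq> 0"
  using degree_root_poly[of m l] by (metis degree_0 nat.distinct(1))

text \<open>Outside the disc of radius \<open>m + 1\<close> the recurrence makes the moduli of the
  values of \<open>path_poly m n\<close> strictly increase with \<open>n\<close>, so the two values
  in \<open>root_poly\<close> cannot agree there.\<close>

lemma root_poly_root_bound:
  assumes "poly (root_poly m l) z = 0"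
  shows "cmod z \<le> real m + 1"
proof (rule ccontr)
  assume "\<not> ?thesis"
  then have z: "cmod z > real m + 1" by simp
  have step: "cmod (poly (path_poly m n) z) < cmod (poly (path_poly m (Suc n)) z)" for n
  proof (induction n)
    case (Suc n)
    let ?q = "\<lambda>n. poly (path_poly m n) z"
    have "cmod (?q (Suc n)) < (cmod z - real m) * cmod (?q (Suc n))"
      using z Suc by (intro mult_less_cancel_right1[THEN iffD2])
        (auto simp: not_le intro: le_less_trans[OF norm_ge_zero])
    also have "\<dots> \<le> cmod z * cmod (?q (Suc n)) - real m * cmod (?q n)"
      using Suc by (simp add: left_diff_distrib mult_left_mono)
    also have "\<dots> \<le> cmod (z * ?q (Suc n) - of_nat m * ?q n)"
      using norm_triangle_ineq2[of "z * ?q (Suc n)" "of_nat m * ?q n"] by (simp add: norm_mult)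
    finally show ?case by simp
  qed (use z in auto)
  \<comment> \<open>The indices are two steps apart, except for \<open>l = 0\<close>, where
    truncated subtraction leaves a single step.\<close>
  have "cmod (poly (path_poly m (l - 1)) z) < cmod (poly (path_poly m (Suc l)) z)"
    using step[of l] step[of "l - 1"] by (cases l) (auto intro: less_trans)
  then show False using assms by (simp add: root_poly_def)
qed

section \<open>Roots and energies of path polynomials\<close>

lemma cos_pi_div_inj:
  assumes "i \<in> {1..n}" "j \<in> {1..n}" "cos (pi * real i / real (n + 1)) = cos (pi * real j / real (n + 1))"
  shows "i = j"
proof -
  have le: "pi * real k / real (n + 1) \<le> pi" if "k \<in> {1..n}" for k
    using that by (simp add: pos_divide_le_eq)
  have ge: "0 \<le> pi * real k / real (n + 1)" for k
    by simp
  have "pi * real i / real (n + 1) = pi * real j / real (n + 1)"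
    by (rule cos_inj_pi[OF ge le[OF assms(1)] ge le[OF assms(2)] assms(3)])
  then have "pi * real i = pi * real j"
    by (simp only: divide_cancel_right) simp
  then show ?thesis by simp
qed

text \<open>Up to scaling, \<open>path_poly\<close> is a Chebyshev polynomial of the second kind.
  The factor \<open>sin t\<close> stays on the left so that no division by zero occurs at multiples
  of pi.\<close>

lemma poly_path_poly_cos:
  "poly (path_poly m n) (of_real (2 * sqrt (real m) * cos t)) * of_real (sin t) =
     of_real (sqrt (real m) ^ n * sin (real (n + 1) * t))"
proof (induction m n rule: path_poly.induct)
  case (2 m)
  show ?case by (simp add: sin_double flip: of_real_mult)
next
  case (3 m n)
  let ?s = "sqrt (real m)"
  have trig: "sin (real (n + 3) * t) = 2 * cos t * sin (real (n + 2) * t) - sin (real (n + 1) * t)"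
  proof -
    have "real (n + 3) * t = real (n + 2) * t + t" "real (n + 1) * t = real (n + 2) * t - t"
      by (auto simp: algebra_simps)
    then show ?thesis by (simp only: sin_add sin_diff) (simp add: algebra_simps)
  qed
  have sq: "of_nat m = (of_real (?s ^ 2) :: complex)" by simp
  have "poly (path_poly m (Suc (Suc n))) (of_real (2 * ?s * cos t)) * of_real (sin t) =
      of_real (2 * ?s * cos t) * (poly (path_poly m (Suc n)) (of_real (2 * ?s * cos t)) * of_real (sin t))
      - of_nat m * (poly (path_poly m n) (of_real (2 * ?s * cos t)) * of_real (sin t))"
    by (simp add: algebra_simps)
  also have "\<dots> = of_real (2 * ?s * cos t * (?s ^ Suc n * sin (real (Suc n + 1) * t))
      - ?s ^ 2 * (?s ^ n * sin (real (n + 1) * t)))"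
    unfolding 3 sq by (simp only: of_real_mult of_real_diff)
  also have "2 * ?s * cos t * (?s ^ Suc n * sin (real (Suc n + 1) * t))
      - ?s ^ 2 * (?s ^ n * sin (real (n + 1) * t)) = ?s ^ Suc (Suc n) * sin (real (n + 3) * t)"
    unfolding trig by (simp add: algebra_simps power2_eq_square)
  finally show ?case by (simp add: algebra_simps)
qed simp

text \<open>At \<open>t = pi j / (n + 1)\<close> the right side of \<open>poly_path_poly_cos\<close>
  vanishes while \<open>sin t\<close> does not. This gives \<open>n\<close> roots, distinct because
  \<open>m > 0\<close> and cosine is injective on [0, pi]; two monic polynomials of degree
  \<open>n\<close> that agree at \<open>n\<close> points are equal.\<close>

lemma path_poly_factorization:
  assumes "m > 0"
  shows "path_poly m n =
    (\<Prod>j\<in>{1..n}. [:- of_real (2 * sqrt (real m) * cos (pi * real j / real (n + 1))), 1:])"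
proof -
  define r where "r j = (of_real (2 * sqrt (real m) * cos (pi * real j / real (n + 1))) :: complex)" for j
  let ?P = "\<Prod>j\<in>{1..n}. [:- r j, 1:]"
  have inj: "inj_on r {1..n}"
    using assms cos_pi_div_inj[of _ n] by (intro inj_onI) (auto simp: r_def)
  have degP: "degree ?P = n" by (subst degree_prod_sum_eq) auto
  have "lead_coeff ?P = 1" by (subst lead_coeff_prod) auto
  then have lcP: "poly.coeff ?P n = 1" by (simp only: degP)
  have "path_poly m n = ?P"
  proof (rule poly_eqI_degree_lead_coeff[where A = "r ` {1..n}" and n = n])
    fix z assume "z \<in> r ` {1..n}"
    then obtain j where j: "j \<in> {1..n}" "z = r j" by auto
    define t where "t = pi * real j / real (n + 1)"
    have "0 < t" "t < pi" using j by (auto simp: t_def divide_simps)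
    then have "sin t > 0" by (rule sin_gt_zero)
    have "real (n + 1) * t = of_nat j * pi" by (simp add: t_def divide_simps)
    then have s0: "sin (real (n + 1) * t) = 0" by (metis sin_npi)
    have "poly (path_poly m n) z = 0"
      using poly_path_poly_cos[of m n t] \<open>sin t > 0\<close> unfolding s0 j(2) r_def t_def[symmetric] by simp
    moreover have "poly ?P z = 0" using j by (auto simp: poly_prod)
    ultimately show "poly (path_poly m n) z = poly ?P z" by simp
  qed (use degP lcP inj in \<open>auto simp: lead_coeff_path_poly card_image\<close>)
  then show ?thesis unfolding r_def .
qed

definition path_energy :: "nat \<Rightarrow> real" where
  "path_energy n = (\<Sum>j\<in>{1..n}. 2 * \<bar>cos (pi * real j / real (n + 1))\<bar>)"

lemma poly_energy_path_poly:
  assumes "m > 0"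
  shows "poly_energy (path_poly m n) = sqrt (real m) * path_energy n"
proof -
  let ?c = "\<lambda>j. 2 * sqrt (real m) * cos (pi * real j / real (n + 1))"
  have "poly_energy (path_poly m n) = (\<Sum>j\<in>{1..n}. poly_energy [:- of_real (?c j), 1:])"
    unfolding path_poly_factorization[OF assms] by (rule poly_energy_prod) simp
  also have "\<dots> = (\<Sum>j\<in>{1..n}. \<bar>?c j\<bar>)"
    by (simp only: poly_energy_linear norm_of_real)
  also have "\<dots> = (\<Sum>j\<in>{1..n}. sqrt (real m) * (2 * \<bar>cos (pi * real j / real (n + 1))\<bar>))"
    by (intro sum.cong refl) (simp only: abs_mult, simp)
  finally show ?thesis by (simp only: path_energy_def sum_distrib_left)
qed

section \<open>The characteristic polynomial of a dendrimer\<close>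

text \<open>The diagonal entry left at \<open>v\<close> after all its descendants are eliminated
  from x I - A; \<open>l - length v\<close> is the height of \<open>v\<close>.\<close>

definition pivot :: "nat \<Rightarrow> nat \<Rightarrow> complex \<Rightarrow> nat list \<Rightarrow> complex" where
  "pivot l m x v =
     (if v = [] then poly (root_poly m l) x / poly (path_poly m l) x
      else poly (path_poly m (Suc (l - length v))) x / poly (path_poly m (l - length v)) x)"

text \<open>The lower factor with the diagonal of pivots already multiplied in: an entry
  \<open>- inverse (pivot child)\<close> times \<open>pivot child\<close> leaves -1.\<close>

definition lower_entry :: "nat \<Rightarrow> nat \<Rightarrow> complex \<Rightarrow> nat list \<Rightarrow> nat list \<Rightarrow> complex" where
  "lower_entry l m x u v = (if u = v then pivot l m x u else if \<exists>c. v = u @ [c] then -1 else 0)"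

definition upper_entry :: "nat \<Rightarrow> nat \<Rightarrow> complex \<Rightarrow> nat list \<Rightarrow> nat list \<Rightarrow> complex" where
  "upper_entry l m x v w =
     (if v = w then 1 else if \<exists>c. v = w @ [c] then - inverse (pivot l m x v) else 0)"

lemma snoc_in_dendrimer_verts_iff:
  "v @ [c] \<in> dendrimer_verts l k \<longleftrightarrow>
     v \<in> dendrimer_verts l k \<and> length v < l \<and> c < (if v = [] then k else k - 1)"
  by (auto simp: dendrimer_verts_def nth_append less_Suc_eq)

lemma children_dendrimer:
  assumes "v \<in> dendrimer_verts l k"
  shows "{w \<in> dendrimer_verts l k. \<exists>c. w = v @ [c]} =
    (if length v < l then (\<lambda>c. v @ [c]) ` {..<(if v = [] then k else k - 1)} else {})"
proof -
  define b where "b = (if v = [] then k else k - 1)"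
  have "v @ [c] \<in> dendrimer_verts l k \<longleftrightarrow> length v < l \<and> c < b" for c
    using assms unfolding b_def by (simp only: snoc_in_dendrimer_verts_iff simp_thms)
  then show ?thesis unfolding b_def[symmetric] by auto
qed

lemma pivot_children_sum:
  assumes l: "l \<ge> 1" and k: "k \<ge> 1"
    and nz: "\<And>h. h \<le> l \<Longrightarrow> poly (path_poly (k - 1) h) x \<noteq> 0"
    and u: "u \<in> dendrimer_verts l k"
  shows "pivot l (k - 1) x u +
    (\<Sum>v\<in>{v \<in> dendrimer_verts l k. \<exists>c. v = u @ [c]}. inverse (pivot l (k - 1) x v)) = x"
proof -
  let ?q = "\<lambda>n. poly (path_poly (k - 1) n) x"
  show ?thesis
  proof (cases "length u < l")
    case False
    then have "length u = l" using u by (simp add: dendrimer_verts_def)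
    with l have "u \<noteq> []" by auto
    then show ?thesis
      using False \<open>length u = l\<close> by (simp add: children_dendrimer[OF u] pivot_def)
  next
    case True
    \<comment> \<open>The height of the children of \<open>u\<close>; the vertex \<open>u\<close>
      itself has height \<open>Suc h\<close>.\<close>
    define h where "h = l - Suc (length u)"
    have h: "Suc h \<le> l" "l - length u = Suc h" using True by (auto simp: h_def)
    let ?b = "if u = [] then k else k - 1"
    have child: "pivot l (k - 1) x (u @ [c]) = ?q (Suc h) / ?q h" for c
      by (simp add: pivot_def h_def)
    have sum_image: "(\<Sum>v\<in>(\<lambda>c. u @ [c]) ` {..<b}. inverse (pivot l (k - 1) x v)) =
        of_nat b * ?q h / ?q (Suc h)" for b
      by (subst sum.reindex) (simp_all add: inj_on_def child del: One_nat_def)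
    have "(\<Sum>v\<in>{v \<in> dendrimer_verts l k. \<exists>c. v = u @ [c]}. inverse (pivot l (k - 1) x v)) =
        (\<Sum>v\<in>(\<lambda>c. u @ [c]) ` {..<?b}. inverse (pivot l (k - 1) x v))"
      using True by (simp add: children_dendrimer[OF u])
    also have "\<dots> = of_nat ?b * ?q h / ?q (Suc h)"
      by (rule sum_image)
    finally have *: "(\<Sum>v\<in>{v \<in> dendrimer_verts l k. \<exists>c. v = u @ [c]}. inverse (pivot l (k - 1) x v)) =
      of_nat ?b * ?q h / ?q (Suc h)" .
    have nz': "?q (Suc h) \<noteq> 0" by (rule nz[OF h(1)])
    have rec: "?q (Suc (Suc h)) = x * ?q (Suc h) - of_nat (k - 1) * ?q h" by simp
    show ?thesis
    proof (cases "u = []")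
      case True
      then have "l = Suc h" using h by simp
      then have "poly (root_poly (k - 1) l) x = x * ?q (Suc h) - of_nat (k - 1) * ?q h - ?q h"
        by (simp add: root_poly_def)
      also have "\<dots> = x * ?q (Suc h) - of_nat k * ?q h"
        using k by (cases k) (simp_all add: algebra_simps)
      finally have "pivot l (k - 1) x u = (x * ?q (Suc h) - of_nat k * ?q h) / ?q (Suc h)"
        using True \<open>l = Suc h\<close> by (simp add: pivot_def)
      then show ?thesis unfolding * using True nz' by (simp add: diff_divide_distrib)
    next
      case False
      then have "pivot l (k - 1) x u = (x * ?q (Suc h) - of_nat (k - 1) * ?q h) / ?q (Suc h)"
        unfolding pivot_def h(2) rec[symmetric] by simp
      then show ?thesis unfolding * using False nz' by (simp add: diff_divide_distrib)
    qed
  qed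
qed

text \<open>Below the root the numerator has index at most \<open>l\<close>, so the assumption
  covers it. The pivot of the root may vanish, but only pivots of children are ever
  inverted.\<close>

lemma pivot_nonzero:
  assumes "\<And>h. h \<le> l \<Longrightarrow> poly (path_poly m h) x \<noteq> 0" "v \<noteq> []" "length v \<le> l"
  shows "pivot l m x v \<noteq> 0"
  using assms(1)[of "l - length v"] assms(1)[of "Suc (l - length v)"] assms(2,3)
  by (cases v) (auto simp: pivot_def Suc_diff_le)

text \<open>Row \<open>u\<close> of the first factor lives on \<open>u\<close> and its children. The
  diagonal is \<open>pivot_children_sum\<close>; if \<open>w\<close> is a child of \<open>u\<close>,
  the -1 comes from the term \<open>v = w\<close>, and if \<open>u\<close> is a child of
  \<open>w\<close>, it comes from the term \<open>v = u\<close>, where the pivot cancels.\<close>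

lemma lower_upper_product:
  assumes l: "l \<ge> 1" and k: "k \<ge> 1"
    and nz: "\<And>h. h \<le> l \<Longrightarrow> poly (path_poly (k - 1) h) x \<noteq> 0"
    and u: "u \<in> dendrimer_verts l k" and w: "w \<in> dendrimer_verts l k"
  shows "(\<Sum>v\<in>dendrimer_verts l k. lower_entry l (k - 1) x u v * upper_entry l (k - 1) x v w) =
    (if u = w then x else 0) - (if (u, w) \<in> parcs (dendrimer l k) then 1 else 0)"
proof -
  let ?V = "dendrimer_verts l k"
  let ?C = "{v \<in> ?V. \<exists>c. v = u @ [c]}"
  let ?F = "lower_entry l (k - 1) x u" and ?H = "\<lambda>v. upper_entry l (k - 1) x v w"
  have fin: "finite ?V" by (rule finite_dendrimer_verts)
  have uC: "u \<notin> ?C" by simp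
  have "(\<Sum>v\<in>?V. ?F v * ?H v) = (\<Sum>v\<in>insert u ?C. ?F v * ?H v)"
    using u by (intro sum.mono_neutral_right fin) (auto simp: lower_entry_def)
  also have "\<dots> = ?F u * ?H u + (\<Sum>v\<in>?C. ?F v * ?H v)"
    using fin uC by (subst sum.insert) auto
  also have "(\<Sum>v\<in>?C. ?F v * ?H v) = - (\<Sum>v\<in>?C. ?H v)"
    unfolding sum_negf[symmetric] by (intro sum.cong refl) (auto simp: lower_entry_def)
  finally have S: "(\<Sum>v\<in>?V. ?F v * ?H v) = pivot l (k - 1) x u * ?H u - (\<Sum>v\<in>?C. ?H v)"
    by (simp add: lower_entry_def)
  show ?thesis
  proof (cases "u = w")
    case True
    have "(\<Sum>v\<in>?C. ?H v) = (\<Sum>v\<in>?C. - inverse (pivot l (k - 1) x v))"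
      using True by (intro sum.cong refl) (auto simp: upper_entry_def)
    then have "(\<Sum>v\<in>?V. ?F v * ?H v) = x"
      unfolding S using True pivot_children_sum[OF l k nz u] by (simp add: upper_entry_def sum_negf)
    moreover have "(u, w) \<notin> parcs (dendrimer l k)" using True by (simp add: dendrimer_def)
    ultimately show ?thesis using True by simp
  next
    case False
    \<comment> \<open>The parent of each \<open>v\<close> in \<open>?C\<close> is \<open>u\<close>,
      which differs from \<open>w\<close>, so only the unit diagonal can contribute.\<close>
    have "(\<Sum>v\<in>?C. ?H v) = (\<Sum>v\<in>?C. if v = w then 1 else 0)"
      using False by (intro sum.cong refl) (auto simp: upper_entry_def)
    also have "\<dots> = (if w \<in> ?C then 1 else 0)" using fin by (subst sum.delta) auto
    finally have C: "(\<Sum>v\<in>?C. ?H v) = (if \<exists>c. w = u @ [c] then 1 else 0)" using w by simp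
    have adj: "(u, w) \<in> parcs (dendrimer l k) \<longleftrightarrow> (\<exists>c. w = u @ [c]) \<or> (\<exists>c. u = w @ [c])"
      using u w by (auto simp: dendrimer_def)
    show ?thesis
    proof (cases "\<exists>c. u = w @ [c]")
      case True
      then have "pivot l (k - 1) x u \<noteq> 0"
        using u by (intro pivot_nonzero nz) (auto simp: dendrimer_verts_def)
      moreover have "\<not> (\<exists>c. w = u @ [c])" using True by auto
      ultimately show ?thesis
        unfolding S C adj using False True by (simp add: upper_entry_def)
    next
      case no: False
      then show ?thesis
        unfolding S C adj using False by (auto simp: upper_entry_def)
    qed
  qed
qed

text \<open>At a point that avoids the zeros of the path polynomials the pivots are well-defined
  numbers, and the determinant of x I - A is the product of two triangular determinants, the second
  of which is 1.\<close>

lemma char_poly_dendrimer_pivots: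
  assumes l: "l \<ge> 1" and k: "k \<ge> 1"
    and nz: "\<And>h. h \<le> l \<Longrightarrow> poly (path_poly (k - 1) h) x \<noteq> 0"
    and vs: "distinct vs" "set vs = dendrimer_verts l k"
  shows "poly (char_poly (adjacency_mat (dendrimer l k) vs)) x =
    (\<Prod>v\<in>dendrimer_verts l k. pivot l (k - 1) x v)"
proof -
  define n where "n = length vs"
  let ?A = "adjacency_mat (dendrimer l k) vs"
  let ?L = "mat n n (\<lambda>(i, j). lower_entry l (k - 1) x (vs ! i) (vs ! j))"
  let ?U = "mat n n (\<lambda>(i, j). upper_entry l (k - 1) x (vs ! i) (vs ! j))"
  have A: "?A \<in> carrier_mat n n" by (simp add: adjacency_mat_def n_def)
  have L: "?L \<in> carrier_mat n n" and U: "?U \<in> carrier_mat n n" by auto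
  have bij: "bij_betw ((!) vs) {0..<n} (dendrimer_verts l k)"
    using bij_betw_nth[OF vs(1) _ vs(2)[symmetric]] by (simp add: n_def atLeast0LessThan)
  have inj: "vs ! i = vs ! j \<longleftrightarrow> i = j" if "i < n" "j < n" for i j
    using nth_eq_iff_index_eq[OF vs(1)] that unfolding n_def by blast
  have mem: "vs ! i \<in> dendrimer_verts l k" if "i < n" for i
    using nth_mem[of i vs] that unfolding n_def vs(2) .
  \<comment> \<open>\<open>char_matrix\<close> stands for A - x I, hence the sign.\<close>
  have "- char_matrix ?A x = ?L * ?U"
  proof (rule eq_matI)
    fix i j assume "i < dim_row (?L * ?U)" "j < dim_col (?L * ?U)"
    then have ij: "i < n" "j < n" by auto
    have "(?L * ?U) $$ (i, j) = (\<Sum>t = 0..<n. lower_entry l (k - 1) x (vs ! i) (vs ! t) *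
        upper_entry l (k - 1) x (vs ! t) (vs ! j))"
      using ij by (simp add: scalar_prod_def)
    also have "\<dots> = (\<Sum>v\<in>dendrimer_verts l k. lower_entry l (k - 1) x (vs ! i) v *
        upper_entry l (k - 1) x v (vs ! j))"
      by (rule sum.reindex_bij_betw[OF bij])
    also have "\<dots> = (if i = j then x else 0) -
        (if (vs ! i, vs ! j) \<in> parcs (dendrimer l k) then 1 else 0)"
      using ij by (subst lower_upper_product[OF l k nz]) (auto simp: mem inj)
    also have "\<dots> = (- char_matrix ?A x) $$ (i, j)"
      using ij A by (simp add: char_matrix_def adjacency_mat_def n_def)
    finally show "(- char_matrix ?A x) $$ (i, j) = (?L * ?U) $$ (i, j)" by simp
  qed (use A in \<open>auto simp: char_matrix_def\<close>)
  then have "poly (char_poly ?A) x = det (?L * ?U)"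
    using char_poly_matrix[OF A, of x] by simp
  also have "\<dots> = det ?L * det ?U" by (rule det_mult[OF L U])
  \<comment> \<open>Off the diagonal this factor goes from parent to child, so the level is a
    suitable grading.\<close>
  also have "det ?L = (\<Prod>i = 0..<n. ?L $$ (i, i))"
    by (rule det_graded_triangular[OF L, where f = "\<lambda>i. length (vs ! i)"])
      (auto simp: lower_entry_def inj split: if_splits)
  also have "\<dots> = (\<Prod>i = 0..<n. pivot l (k - 1) x (vs ! i))"
    by (intro prod.cong refl) (simp add: lower_entry_def)
  also have "\<dots> = (\<Prod>v\<in>dendrimer_verts l k. pivot l (k - 1) x v)"
    by (rule prod.reindex_bij_betw[OF bij])
  \<comment> \<open>This factor goes from child to parent, so the grading is the height.\<close>
  also have "det ?U = (\<Prod>i = 0..<n. ?U $$ (i, i))"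
  proof (rule det_graded_triangular[OF U, where f = "\<lambda>i. l - length (vs ! i)"])
    fix i j assume ij: "i < n" "j < n" "i \<noteq> j" "?U $$ (i, j) \<noteq> 0"
    then have "\<exists>c. vs ! i = vs ! j @ [c]" by (auto simp: upper_entry_def inj split: if_splits)
    then have "length (vs ! i) = Suc (length (vs ! j))" by auto
    moreover have "length (vs ! i) \<le> l" using mem[OF ij(1)] by (simp add: dendrimer_verts_def)
    ultimately show "l - length (vs ! i) < l - length (vs ! j)" by linarith
  qed
  also have "\<dots> = 1" by (intro prod.neutral) (simp add: upper_entry_def)
  finally show ?thesis by simp
qed

section \<open>Level sizes and the energy formula\<close>

lemma card_dendrimer_level:
  assumes "i \<le> l"
  shows "card {v \<in> dendrimer_verts l k. length v = i} = (if i = 0 then 1 else k * (k - 1) ^ (i - 1))"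
  using assms
proof (induction i)
  case 0
  have "{v \<in> dendrimer_verts l k. length v = 0} = {[]}" by (auto simp: dendrimer_verts_def)
  then show ?case by simp
next
  case (Suc i)
  let ?b = "if i = 0 then k else k - 1"
  have "{v \<in> dendrimer_verts l k. length v = Suc i} =
      (\<lambda>(v, c). v @ [c]) ` ({v \<in> dendrimer_verts l k. length v = i} \<times> {..<?b})" (is "?A = ?B")
  proof (rule Set.set_eqI)
    fix v show "v \<in> ?A \<longleftrightarrow> v \<in> ?B"
      using Suc.prems
      by (cases v rule: rev_cases) (auto simp: snoc_in_dendrimer_verts_iff image_iff split: if_splits)
  qed
  also have "card \<dots> = card {v \<in> dendrimer_verts l k. length v = i} * ?b"
    by (subst card_image) (auto simp: inj_on_def card_cartesian_product)
  finally show ?case using Suc by (cases i) (auto simp: algebra_simps)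
qed

text \<open>The pivot depends only on the level. Apart from the root, level \<open>i\<close> is
  reindexed by the height \<open>h = l - i\<close>, which turns the level size into the exponent
  shown.\<close>

lemma prod_pivot:
  assumes l: "l \<ge> 1"
  shows "(\<Prod>v\<in>dendrimer_verts l k. pivot l (k - 1) x v) =
    poly (root_poly (k - 1) l) x / poly (path_poly (k - 1) l) x *
    (\<Prod>h<l. (poly (path_poly (k - 1) (Suc h)) x / poly (path_poly (k - 1) h) x) ^
       (k * (k - 1) ^ (l - 1 - h)))"
proof -
  let ?V = "dendrimer_verts l k"
  define g where "g i = (if i = 0 then poly (root_poly (k - 1) l) x / poly (path_poly (k - 1) l) x
    else poly (path_poly (k - 1) (Suc (l - i))) x / poly (path_poly (k - 1) (l - i)) x)" for i
  have piv: "pivot l (k - 1) x v = g (length v)" for v by (simp add: pivot_def g_def)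
  have "(\<Prod>v\<in>?V. g (length v)) = (\<Prod>i\<in>{..l}. \<Prod>v\<in>{v \<in> ?V. length v = i}. g (length v))"
    by (rule prod.group[OF finite_dendrimer_verts, symmetric]) (auto simp: dendrimer_verts_def)
  also have "\<dots> = (\<Prod>i\<in>{..l}. g i ^ (if i = 0 then 1 else k * (k - 1) ^ (i - 1)))"
    by (intro prod.cong refl) (simp add: card_dendrimer_level del: power_Suc)
  also have "{..l} = insert 0 {1..l}" by auto
  also have "(\<Prod>i\<in>insert 0 {1..l}. g i ^ (if i = 0 then 1 else k * (k - 1) ^ (i - 1))) =
      g 0 * (\<Prod>i\<in>{1..l}. g i ^ (k * (k - 1) ^ (i - 1)))"
    by (subst prod.insert) auto
  also have "(\<Prod>i\<in>{1..l}. g i ^ (k * (k - 1) ^ (i - 1))) =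
      (\<Prod>h<l. (poly (path_poly (k - 1) (Suc h)) x / poly (path_poly (k - 1) h) x) ^
       (k * (k - 1) ^ (l - 1 - h)))"
    by (rule prod.reindex_bij_witness[where i = "\<lambda>h. l - h" and j = "\<lambda>i. l - i"])
      (auto simp: g_def)
  finally show ?thesis unfolding piv by (simp add: g_def)
qed

text \<open>
  The denominators of the pivots are multiplied out on both sides, since truncated subtraction would
  get in the way of cancelled exponents.
\<close>

lemma char_poly_dendrimer:
  assumes l: "l \<ge> 1" and k: "k \<ge> 1"
    and vs: "distinct vs" "set vs = dendrimer_verts l k"
  shows "char_poly (adjacency_mat (dendrimer l k) vs) * (path_poly (k - 1) l *
      (\<Prod>h<l. path_poly (k - 1) h ^ (k * (k - 1) ^ (l - 1 - h)))) =
    root_poly (k - 1) l * (\<Prod>h<l. path_poly (k - 1) (Suc h) ^ (k * (k - 1) ^ (l - 1 - h)))"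
    (is "?lhs = ?rhs")
proof (rule ccontr)
  \<comment> \<open>\<open>?Z\<close> vanishes wherever some pivot could be undefined. The
    difference times \<open>?Z\<close> is therefore zero at every point, hence zero as a polynomial,
    and \<open>?Z\<close> is a nonzero factor.\<close>
  let ?Z = "\<Prod>h\<le>l. path_poly (k - 1) h"
  assume "?lhs \<noteq> ?rhs"
  then have nz: "(?lhs - ?rhs) * ?Z \<noteq> 0" by simp
  have "poly ((?lhs - ?rhs) * ?Z) x = 0" for x
  proof (cases "poly ?Z x = 0")
    case False
    then have q: "poly (path_poly (k - 1) h) x \<noteq> 0" if "h \<le> l" for h
      using that by (auto simp: poly_prod)
    let ?q = "\<lambda>h. poly (path_poly (k - 1) h) x" and ?n = "\<lambda>h. k * (k - 1) ^ (l - 1 - h)"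
    have pos: "(\<Prod>h<l. ?q h ^ ?n h) \<noteq> 0" using q by auto
    have "poly (char_poly (adjacency_mat (dendrimer l k) vs)) x =
        (\<Prod>v\<in>dendrimer_verts l k. pivot l (k - 1) x v)"
      by (rule char_poly_dendrimer_pivots[OF l k _ vs]) (rule q)
    also have "\<dots> = poly (root_poly (k - 1) l) x / ?q l * ((\<Prod>h<l. ?q (Suc h) ^ ?n h) / (\<Prod>h<l. ?q h ^ ?n h))"
      unfolding prod_pivot[OF l] by (simp only: power_divide prod_dividef)
    finally have "poly ?lhs x = poly ?rhs x"
      using pos q[of l] by (simp add: poly_prod poly_power)
    then show ?thesis by (simp only: poly_diff poly_mult) simp
  qed (simp only: poly_mult, simp)
  then have "(?lhs - ?rhs) * ?Z = 0" by (simp only: poly_all_0_iff_0[symmetric]) simp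
  with nz show False by contradiction
qed

text \<open>Apply \<open>poly_energy\<close> to both sides of \<open>char_poly_dendrimer\<close>.
  The products over \<open>h\<close> pair up into differences of consecutive path energies, and the
  lone factor \<open>path_poly (k - 1) l\<close> becomes the subtracted term.\<close>

lemma energy_dendrimer:
  assumes l: "l \<ge> 1" and k: "k \<ge> 2"
  shows "graph_energy (dendrimer l k) = poly_energy (root_poly (k - 1) l) +
    sqrt (real k - 1) * (real k * (\<Sum>h<l. (real k - 1) ^ (l - 1 - h) *
      (path_energy (Suc h) - path_energy h)) - path_energy l)"
proof -
  define vs where "vs = (SOME vs. distinct vs \<and> set vs = pverts (dendrimer l k))"
  have "\<exists>vs. distinct vs \<and> set vs = pverts (dendrimer l k)"
    using finite_distinct_list[OF finite_dendrimer_verts, of l k] by (auto simp: dendrimer_def)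
  from someI_ex[OF this] have vs: "distinct vs" "set vs = dendrimer_verts l k"
    unfolding vs_def[symmetric] by (simp_all add: dendrimer_def)
  have k1: "k \<ge> 1" and m: "k - 1 > 0" using k by auto
  let ?P = "char_poly (adjacency_mat (dendrimer l k) vs)"
  let ?n = "\<lambda>h. k * (k - 1) ^ (l - 1 - h)"
  have E: "graph_energy (dendrimer l k) = poly_energy ?P"
    by (simp add: graph_energy_def poly_energy_def vs_def)
  have "adjacency_mat (dendrimer l k) vs \<in> carrier_mat (length vs) (length vs)"
    by (simp add: adjacency_mat_def)
  then have P0: "?P \<noteq> 0" using degree_monic_char_poly by force
  have "poly_energy ?P + (poly_energy (path_poly (k - 1) l) +
        (\<Sum>h<l. real (?n h) * poly_energy (path_poly (k - 1) h))) =
      poly_energy (root_poly (k - 1) l) + (\<Sum>h<l. real (?n h) * poly_energy (path_poly (k - 1) (Suc h)))"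
    using arg_cong[OF char_poly_dendrimer[OF l k1 vs], of poly_energy] P0
    by (simp add: poly_energy_mult poly_energy_prod poly_energy_power del: path_poly.simps)
  then have "poly_energy ?P = poly_energy (root_poly (k - 1) l) +
      (\<Sum>h<l. real (?n h) * (poly_energy (path_poly (k - 1) (Suc h)) - poly_energy (path_poly (k - 1) h)))
      - poly_energy (path_poly (k - 1) l)"
    by (simp add: right_diff_distrib sum_subtractf)
  also have "(\<Sum>h<l. real (?n h) * (poly_energy (path_poly (k - 1) (Suc h)) - poly_energy (path_poly (k - 1) h)))
     = sqrt (real k - 1) * (real k * (\<Sum>h<l. (real k - 1) ^ (l - 1 - h) *
      (path_energy (Suc h) - path_energy h)))"
    unfolding sum_distrib_left poly_energy_path_poly[OF m]
    using k1 by (intro sum.cong refl) (simp add: of_nat_diff algebra_simps)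
  also have "poly_energy (path_poly (k - 1) l) = sqrt (real k - 1) * path_energy l"
    unfolding poly_energy_path_poly[OF m] using k1 by (simp add: of_nat_diff)
  finally show ?thesis unfolding E by (simp add: right_diff_distrib)
qed

section \<open>Energies of paths\<close>

lemma path_energy_0 [simp]: "path_energy 0 = 0"
  by (simp add: path_energy_def)

lemma path_energy_nonneg: "path_energy n \<ge> 0"
  unfolding path_energy_def by (intro sum_nonneg) simp

lemma path_energy_le: "path_energy n \<le> 2 * real n"
proof -
  have "path_energy n \<le> (\<Sum>j\<in>{1..n}. 2)"
    unfolding path_energy_def by (intro sum_mono) simp
  then show ?thesis by simp
qed

text \<open>The Dirichlet kernel: \<open>2 sin (t / 2) cos (j t)\<close> is the difference of
  \<open>sin ((j + 1/2) t)\<close> and \<open>sin ((j - 1/2) t)\<close>, so the sum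
  telescopes.\<close>

lemma sum_cos_multiples:
  "sin (t / 2) * (\<Sum>j\<in>{1..p}. 2 * cos (real j * t)) = sin ((real p + 1 / 2) * t) - sin (t / 2)"
proof (induction p)
  case (Suc p)
  have *: "(real (Suc p) + 1 / 2) * t = real (Suc p) * t + t / 2"
    "(real p + 1 / 2) * t = real (Suc p) * t - t / 2"
    by (simp_all add: algebra_simps)
  have "sin (t / 2) * (2 * cos (real (Suc p) * t)) =
      sin ((real (Suc p) + 1 / 2) * t) - sin ((real p + 1 / 2) * t)"
    unfolding * sin_add sin_diff by (simp only: algebra_simps)
  then show ?case using Suc by (simp add: distrib_left)
qed simp

lemma path_energy_half:
  assumes "n = 2 * p \<or> n = 2 * p + 1"
  shows "path_energy n = 2 * (\<Sum>j\<in>{1..p}. 2 * cos (real j * (pi / real (n + 1))))"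
proof -
  define g where "g j = 2 * \<bar>cos (pi * real j / real (n + 1))\<bar>" for j
  have sym: "g (n + 1 - j) = g j" if "j \<le> n + 1" for j
  proof -
    have "pi * real (n + 1 - j) / real (n + 1) = pi - pi * real j / real (n + 1)"
      using that by (simp add: of_nat_diff field_simps)
    then show ?thesis by (simp only: g_def cos_pi_minus abs_minus_cancel)
  qed
  have "p \<le> n" using assms by auto
  then have "(\<Sum>j\<in>{n + 1 - p..n}. g j) = (\<Sum>j\<in>{1..p}. g j)"
    by (intro sum.reindex_bij_witness[where i = "\<lambda>j. n + 1 - j" and j = "\<lambda>j. n + 1 - j"])
      (auto simp: sym[simplified])
  moreover have "path_energy n = (\<Sum>j\<in>{1..p}. g j) + (\<Sum>j\<in>{n + 1 - p..n}. g j)"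
  proof (cases "n = 2 * p")
    case True
    have "{1..n} = {1..p} \<union> {n + 1 - p..n}" using True by auto
    then show ?thesis using True
      unfolding path_energy_def g_def[symmetric] by (simp add: sum.union_disjoint)
  next
    case False
    then have n: "n = 2 * p + 1" using assms by simp
    then have "pi * real (p + 1) / real (n + 1) = pi / 2" by (simp add: field_simps)
    then have mid: "g (p + 1) = 0" by (simp only: g_def cos_pi_half)
    have "{1..n} = insert (p + 1) ({1..p} \<union> {n + 1 - p..n})" using n by auto
    then show ?thesis using n mid
      unfolding path_energy_def g_def[symmetric] by (simp add: sum.union_disjoint)
  qed
  moreover have "(\<Sum>j\<in>{1..p}. g j) = (\<Sum>j\<in>{1..p}. 2 * cos (real j * (pi / real (n + 1))))"
  proof (rule sum.cong[OF refl])
    fix j assume "j \<in> {1..p}"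
    then have "2 * real j \<le> real (n + 1)" using assms by auto
    then have "real j / real (n + 1) \<le> 1 / 2" by (simp add: divide_simps)
    then have "real j * (pi / real (n + 1)) \<le> pi / 2"
      using mult_left_mono[of "real j / real (n + 1)" "1 / 2" pi] by (simp add: mult.commute)
    moreover have "0 \<le> real j * (pi / real (n + 1))" by simp
    ultimately have "cos (real j * (pi / real (n + 1))) \<ge> 0"
      using pi_gt_zero by (intro cos_ge_zero; linarith)
    then show "g j = 2 * cos (real j * (pi / real (n + 1)))"
      by (simp add: g_def mult.commute)
  qed
  ultimately show ?thesis by simp
qed

lemma sin_half_angle_pos: "sin (pi / (2 * real n + 2)) > 0"
  by (intro sin_gt_zero) (simp_all add: field_simps add_pos_nonneg)

text \<open>For \<open>n = 2 p\<close> and \<open>t = pi / (n + 1)\<close> the end angle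
  \<open>(p + 1/2) t\<close> of the Dirichlet sum is exactly pi/2, so its sine is 1.\<close>

lemma path_energy_even:
  assumes "even n"
  shows "path_energy n = 2 * csc (pi / (2 * real n + 2)) - 2"
proof -
  obtain p where p: "n = 2 * p" using assms by (elim evenE)
  let ?t = "pi / real (n + 1)"
  have half: "?t / 2 = pi / (2 * real n + 2)" by (simp add: field_simps)
  have "(real p + 1 / 2) * ?t = pi / 2" using p by (simp add: field_simps)
  then have "sin (?t / 2) * (\<Sum>j\<in>{1..p}. 2 * cos (real j * ?t)) = 1 - sin (?t / 2)"
    using sum_cos_multiples[of ?t p] by (simp only: sin_pi_half)
  then have "(\<Sum>j\<in>{1..p}. 2 * cos (real j * ?t)) = (1 - sin (?t / 2)) / sin (?t / 2)"
    using sin_half_angle_pos[of n] unfolding half by (simp add: field_simps)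
  then show ?thesis
    using sin_half_angle_pos[of n] path_energy_half[of n p] p unfolding half
    by (simp add: csc_def diff_divide_distrib)
qed

text \<open>For \<open>n = 2 p + 1\<close> the end angle falls short of pi/2 by
  \<open>t / 2\<close>; its sine is \<open>cos (t / 2)\<close>, which turns the cosecant of the even
  case into a cotangent.\<close>

lemma path_energy_odd:
  assumes "odd n"
  shows "path_energy n = 2 * cot (pi / (2 * real n + 2)) - 2"
proof -
  obtain p where p: "n = 2 * p + 1" using assms by (elim oddE)
  let ?t = "pi / real (n + 1)"
  have half: "?t / 2 = pi / (2 * real n + 2)" by (simp add: field_simps)
  have "(real p + 1 / 2) * ?t = pi / 2 - ?t / 2" using p by (simp add: field_simps)
  then have "sin (?t / 2) * (\<Sum>j\<in>{1..p}. 2 * cos (real j * ?t)) = cos (?t / 2) - sin (?t / 2)"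
    using sum_cos_multiples[of ?t p] by (simp add: sin_diff)
  then have "(\<Sum>j\<in>{1..p}. 2 * cos (real j * ?t)) = (cos (?t / 2) - sin (?t / 2)) / sin (?t / 2)"
    using sin_half_angle_pos[of n] unfolding half by (simp add: field_simps)
  then show ?thesis
    using sin_half_angle_pos[of n] path_energy_half[of n p] p unfolding half
    by (simp add: cot_def diff_divide_distrib)
qed

lemma path_energy_1 [simp]: "path_energy (Suc 0) = 0"
  by (simp add: path_energy_def)

lemma path_energy_2: "path_energy 2 = 2"
  using path_energy_even[of 2] by (simp add: csc_def sin_30)

text \<open>\<open>j\<close> and \<open>j + 2\<close> have the same parity, so both energies use the
  same closed form and the constants -2 cancel.\<close>

lemma energy_coeff_eq: "energy_coeff j = path_energy (j + 2) - path_energy j"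
proof -
  have "2 * real j + 6 = 2 * real (j + 2) + 2" by simp
  then show ?thesis
    unfolding energy_coeff_def by (simp only: path_energy_even path_energy_odd even_add) 
      (simp add: path_energy_even path_energy_odd)
qed

text \<open>Cosecant and cotangent both decrease on (0, pi/2], which contains both angles; the
  larger one equals pi/2 for \<open>j = 0\<close>.\<close>

lemma energy_coeff_pos: "energy_coeff j > 0"
proof -
  define a where "a = pi / (2 * real j + 6)"
  define b where "b = pi / (2 * real j + 2)"
  have ab: "0 < a" "a < b" "b \<le> pi / 2"
    unfolding a_def b_def using divide_left_mono[of 2 "2 * real j + 2" pi]
    by (auto intro!: divide_strict_left_mono mult_pos_pos add_nonneg_pos)
  have sins: "0 < sin a" "sin a < sin b"
    using ab by (auto intro!: sin_gt_zero sin_monotone_2pi)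
  show ?thesis
  proof (cases "even j")
    case True
    have "csc b < csc a" unfolding csc_def using sins by (intro divide_strict_left_mono) auto
    then show ?thesis using True by (simp add: energy_coeff_def a_def b_def)
  next
    case False
    have "cos b \<ge> 0" using ab by (intro cos_ge_zero) auto
    moreover have "cos b < cos a" using ab by (intro cos_monotone_0_pi) auto
    ultimately have "cot b < cot a" unfolding cot_def using sins by (intro frac_less) auto
    then show ?thesis using False by (simp add: energy_coeff_def a_def b_def)
  qed
qed

section \<open>The power series of the path energies\<close>

lemma summable_path_energy:
  assumes "0 \<le> y" "y < 1"
  shows "summable (\<lambda>h. path_energy h * y ^ h)"
proof (rule summable_comparison_test')
  have "(\<lambda>n. of_nat (Suc n) * y ^ n) sums (1 / (1 - y) ^ 2)"
    using assms by (intro geometric_deriv_sums) simp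
  then show "summable (\<lambda>n. 2 * (real (Suc n) * y ^ n))"
    by (intro summable_mult) (rule sums_summable)
  show "norm (path_energy n * y ^ n) \<le> 2 * (real (Suc n) * y ^ n)" for n
  proof -
    have "path_energy n * y ^ n \<le> (2 * real (Suc n)) * y ^ n"
      using path_energy_le[of n] assms by (intro mult_right_mono) auto
    then show ?thesis using path_energy_nonneg[of n] assms by (simp only: mult.assoc) simp
  qed
qed

text \<open>Since the path energies at 0 and 1 vanish, shifting the index by one or two leaves no
  boundary terms and merely divides \<open>G\<close> by \<open>y\<close> or
  \<open>y ^ 2\<close>.\<close>

lemma path_energy_difference_sums:
  assumes y: "0 < y" "y < 1"
  defines "G \<equiv> (\<Sum>h. path_energy h * y ^ h)"
  shows "(\<lambda>h. (path_energy (Suc h) - path_energy h) * y ^ h) sums (G / y - G)"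
    and "(\<lambda>h. (path_energy (h + 2) - path_energy h) * y ^ h) sums (G / y ^ 2 - G)"
proof -
  let ?g = "\<lambda>h. path_energy h * y ^ h"
  have g: "?g sums G" unfolding G_def using y by (intro summable_sums summable_path_energy) auto
  have "(\<lambda>h. ?g (Suc h)) sums G" using g by (subst sums_Suc_iff) simp
  then have g1: "(\<lambda>h. ?g (Suc h) / y) sums (G / y)" by (rule sums_divide)
  have "(\<lambda>h. ?g (Suc (Suc h))) sums G"
    using \<open>(\<lambda>h. ?g (Suc h)) sums G\<close> by (subst sums_Suc_iff) simp
  then have g2: "(\<lambda>h. ?g (Suc (Suc h)) / y ^ 2) sums (G / y ^ 2)" by (rule sums_divide)
  show "(\<lambda>h. (path_energy (Suc h) - path_energy h) * y ^ h) sums (G / y - G)"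
    using sums_diff[OF g1 g] y by (simp add: left_diff_distrib)
  show "(\<lambda>h. (path_energy (h + 2) - path_energy h) * y ^ h) sums (G / y ^ 2 - G)"
    using sums_diff[OF g2 g] y by (simp add: left_diff_distrib power2_eq_square)
qed

section \<open>Asymptotics\<close>

lemma powr_minus_half:
  fixes m :: real
  assumes "m > 0"
  shows "m powr (real l - 1 / 2) = m ^ l / sqrt m"
  using assms by (simp add: powr_diff powr_realpow powr_half_sqrt)

text \<open>Both limits start from this normalised form: a contribution of the root, a partial sum
  of a series in \<open>1 / m\<close>, and a boundary term.\<close>

lemma energy_dendrimer_ratio:
  assumes l: "l \<ge> 1" and k: "k \<ge> 2"
  defines "m \<equiv> real k - 1"
  shows "graph_energy (dendrimer l k) / m powr (real l - 1 / 2) =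
    poly_energy (root_poly (k - 1) l) * sqrt m * (1 / m) ^ l +
    (\<Sum>h<l. real k * (1 / m) ^ h * (path_energy (Suc h) - path_energy h)) -
    path_energy l * (1 / m) ^ (l - 1)"
proof -
  have m: "m > 0" using k by (simp add: m_def)
  let ?d = "\<lambda>h. path_energy (Suc h) - path_energy h"
  have sq: "sqrt m * sqrt m = m" using m by simp
  have expand: "(a + sqrt m * b) * sqrt m / c = a * sqrt m / c + (sqrt m * sqrt m) * b / c" for a b c
    by (simp add: add_divide_distrib algebra_simps del: real_sqrt_mult_self)
  have pow: "m * m ^ (l - 1 - h) / m ^ l = (1 / m) ^ h" if "h < l" for h
  proof -
    have "m ^ l = m * m ^ (l - 1 - h) * m ^ h"
      using that by (simp flip: power_Suc power_add)
    then show ?thesis using m by (simp add: power_one_over)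
  qed
  have pl: "m / m ^ l = (1 / m) ^ (l - 1)"
    using pow[of "l - 1"] l by simp
  have "graph_energy (dendrimer l k) / m powr (real l - 1 / 2) =
      (poly_energy (root_poly (k - 1) l) +
        sqrt m * (real k * (\<Sum>h<l. m ^ (l - 1 - h) * ?d h) - path_energy l)) * sqrt m / m ^ l"
    unfolding energy_dendrimer[OF l k] powr_minus_half[OF m] m_def[symmetric] by simp
  also have "\<dots> = poly_energy (root_poly (k - 1) l) * sqrt m / m ^ l +
      (sqrt m * sqrt m) * (real k * (\<Sum>h<l. m ^ (l - 1 - h) * ?d h) - path_energy l) / m ^ l"
    by (rule expand)
  also have "\<dots> = poly_energy (root_poly (k - 1) l) * sqrt m / m ^ l +
      (\<Sum>h<l. real k * (m * m ^ (l - 1 - h) / m ^ l) * ?d h) - path_energy l * (m / m ^ l)"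
    unfolding sq by (simp add: right_diff_distrib diff_divide_distrib sum_distrib_left
        sum_divide_distrib mult_ac)
  also have "(\<Sum>h<l. real k * (m * m ^ (l - 1 - h) / m ^ l) * ?d h) =
      (\<Sum>h<l. real k * (1 / m) ^ h * ?d h)"
    by (intro sum.cong refl) (simp only: pow lessThan_iff)
  finally show ?thesis unfolding pl by (simp add: power_one_over)
qed

lemma root_poly_energy_le:
  "k \<ge> 1 \<Longrightarrow> poly_energy (root_poly (k - 1) l) \<le> real (Suc l) * real k"
  using poly_energy_le[of "root_poly (k - 1) l" "real k"] root_poly_root_bound[of "k - 1" l]
  by (simp add: of_nat_diff)

text \<open>The star needs its own computation: its energy comes entirely from
  \<open>root_poly\<close>, here x^2 - k, and the bound \<open>root_poly_energy_le\<close> is too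
  weak for \<open>l = 1\<close>.\<close>

lemma energy_dendrimer_1:
  assumes "k \<ge> 2"
  shows "graph_energy (dendrimer 1 k) = 2 * sqrt (real k)"
proof -
  let ?s = "of_real (sqrt (real k)) :: complex"
  have "?s * ?s = of_nat k" by (simp flip: of_real_mult)
  then have "root_poly (k - 1) 1 = [:- ?s, 1:] * [:- (- ?s), 1:]"
    using assms by (simp add: root_poly_def of_nat_diff one_pCons)
  then have "poly_energy (root_poly (k - 1) 1) = 2 * sqrt (real k)"
    by (simp only: poly_energy_mult[of "[:- ?s, 1:]" "[:- (- ?s), 1:]"] poly_energy_linear
        pCons_eq_0_iff one_neq_zero simp_thms norm_minus_cancel) simp
  then show ?thesis using energy_dendrimer[of 1 k] assms by simp
qed

lemma energy_asymp_degree: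
  assumes "l \<ge> 1"
  shows "(\<lambda>k. graph_energy (dendrimer l k)) \<sim>[at_top] (\<lambda>k. 2 * (real k - 1) powr (real l - 1 / 2))"
proof (cases "l = 1")
  case True
  have ev: "\<forall>\<^sub>F k in at_top. graph_energy (dendrimer l k) = 2 * sqrt (real k)"
    unfolding True using eventually_ge_at_top[of 2] by (rule eventually_mono) (rule energy_dendrimer_1)
  have "(\<lambda>k::nat. 2 * sqrt (real k)) \<sim>[at_top] (\<lambda>k. 2 * (real k - 1) powr (1 / 2))"
    by real_asymp
  from asymp_equiv_trans[OF asymp_equiv_refl_ev[OF ev] this] show ?thesis using True by simp
next
  case False
  with assms have l: "l \<ge> 2" by simp
  let ?m = "\<lambda>k. real k - 1"
  let ?d = "\<lambda>h. path_energy (Suc h) - path_energy h"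
  have y: "(\<lambda>k. 1 / ?m k) \<longlonglongrightarrow> 0" and ky: "(\<lambda>k. real k * (1 / ?m k)) \<longlonglongrightarrow> 1"
    by real_asymp+
  \<comment> \<open>With \<open>l >= 2\<close> the root contribution is at most a constant times
    \<open>k sqrt m / m ^ 2\<close>, which is of order \<open>k\<close> to the power -1/2.\<close>
  have root: "(\<lambda>k. poly_energy (root_poly (k - 1) l) * sqrt (?m k) * (1 / ?m k) ^ l) \<longlonglongrightarrow> 0"
  proof (rule tendsto_sandwich[OF _ _ tendsto_const])
    show "\<forall>\<^sub>F k in at_top. 0 \<le> poly_energy (root_poly (k - 1) l) * sqrt (?m k) * (1 / ?m k) ^ l"
      using eventually_ge_at_top[of 2] by eventually_elim (auto intro!: mult_nonneg_nonneg poly_energy_nonneg)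
    show "\<forall>\<^sub>F k in at_top. poly_energy (root_poly (k - 1) l) * sqrt (?m k) * (1 / ?m k) ^ l \<le>
        real (Suc l) * (real k * sqrt (?m k) * (1 / ?m k) ^ 2)"
      using eventually_ge_at_top[of 2]
    proof eventually_elim
      case (elim k)
      have "(1 / ?m k) ^ l \<le> (1 / ?m k) ^ 2"
        using elim l by (intro power_decreasing) auto
      then have "poly_energy (root_poly (k - 1) l) * sqrt (?m k) * (1 / ?m k) ^ l \<le>
          (real (Suc l) * real k) * sqrt (?m k) * (1 / ?m k) ^ 2"
        using elim root_poly_energy_le[of k l] by (intro mult_mono) auto
      then show ?case by (simp only: mult.assoc)
    qed
    have "(\<lambda>k::nat. real k * sqrt (?m k) * (1 / ?m k) ^ 2) \<longlonglongrightarrow> 0" by real_asymp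
    from tendsto_mult_right_zero[OF this]
    show "(\<lambda>k. real (Suc l) * (real k * sqrt (?m k) * (1 / ?m k) ^ 2)) \<longlonglongrightarrow> 0" .
  qed
  \<comment> \<open>The factor \<open>k\<close> absorbs one power of \<open>1 / m\<close>. The term
    \<open>h = 0\<close> is zero, \<open>h = 1\<close> tends to the difference of path energies at 2
    and 1, which is 2, and later terms retain a factor tending to 0.\<close>
  have term_lim: "(\<lambda>k. real k * (1 / ?m k) ^ h * ?d h) \<longlonglongrightarrow> (if h = 1 then 2 else 0)" for h
  proof -
    consider "h = 0" | "h = 1" | i where "h = Suc (Suc i)" by (cases h; cases "h - 1") auto
    then show ?thesis
    proof cases
      case 2
      then show ?thesis using tendsto_mult_right[OF ky, of 2] path_energy_2
        by (simp add: numeral_2_eq_2)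
    next
      case 3
      have "(\<lambda>k. (real k * (1 / ?m k)) * (1 / ?m k) * (1 / ?m k) ^ i * ?d h) \<longlonglongrightarrow> 1 * 0 * 0 ^ i * ?d h"
        by (intro tendsto_intros ky y)
      then show ?thesis using 3 by (simp add: mult.assoc)
    qed simp
  qed
  have "(\<lambda>k. \<Sum>h<l. real k * (1 / ?m k) ^ h * ?d h) \<longlonglongrightarrow> (\<Sum>h<l. if h = 1 then 2 else 0)"
    by (intro tendsto_sum term_lim)
  also have "(\<Sum>h<l. if h = 1 then 2 else 0) = (2::real)" using l by simp
  finally have sum_lim: "(\<lambda>k. \<Sum>h<l. real k * (1 / ?m k) ^ h * ?d h) \<longlonglongrightarrow> 2" .
  have "(\<lambda>k. path_energy l * (1 / ?m k) ^ (l - 1)) \<longlonglongrightarrow> path_energy l * 0 ^ (l - 1)"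
    by (intro tendsto_intros y)
  then have last: "(\<lambda>k. path_energy l * (1 / ?m k) ^ (l - 1)) \<longlonglongrightarrow> 0" using l by (simp add: power_0_left)
  have "(\<lambda>k. poly_energy (root_poly (k - 1) l) * sqrt (?m k) * (1 / ?m k) ^ l +
      (\<Sum>h<l. real k * (1 / ?m k) ^ h * ?d h) - path_energy l * (1 / ?m k) ^ (l - 1)) \<longlonglongrightarrow> 0 + 2 - 0"
    by (intro tendsto_diff tendsto_add root sum_lim last)
  moreover have "\<forall>\<^sub>F k in at_top. poly_energy (root_poly (k - 1) l) * sqrt (?m k) * (1 / ?m k) ^ l +
      (\<Sum>h<l. real k * (1 / ?m k) ^ h * ?d h) - path_energy l * (1 / ?m k) ^ (l - 1) =
      graph_energy (dendrimer l k) / ?m k powr (real l - 1 / 2)"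
    using eventually_ge_at_top[of 2]
    by (rule eventually_mono) (rule energy_dendrimer_ratio[OF assms, symmetric])
  ultimately have "(\<lambda>k. graph_energy (dendrimer l k) / ?m k powr (real l - 1 / 2)) \<longlonglongrightarrow> 0 + 2 - 0"
    by (rule Lim_transform_eventually)
  then have "(\<lambda>k. graph_energy (dendrimer l k) / ?m k powr (real l - 1 / 2)) \<longlonglongrightarrow> 2"
    by simp
  from tendsto_divide[OF this tendsto_const[of 2]] show ?thesis
    by (intro asymp_equivI') (simp add: mult.commute)
qed

text \<open>The four facts share one proof because all of them rest on \<open>G\<close>, the
  generating function of the path energies at \<open>y = 1 / (k - 1)\<close>.\<close>

lemma
  fixes k :: nat
  assumes k: "k \<ge> 3"
  shows energy_series_pos: "energy_coeff j * (real k - 1) powi (- int j) > 0"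
    and energy_series_summable: "summable (\<lambda>j. energy_coeff j * (real k - 1) powi (- int j))"
    and energy_const_pos: "energy_const k > 0"
    and energy_asymp_levels: "(\<lambda>l. graph_energy (dendrimer l k))
      \<sim>[at_top] (\<lambda>l. energy_const k * (real k - 1) powr (real l - 1 / 2))"
proof -
  define m where "m = real k - 1"
  define y where "y = 1 / m"
  define G where "G = (\<Sum>h. path_energy h * y ^ h)"
  let ?d = "\<lambda>h. path_energy (Suc h) - path_energy h"
  have m: "m \<ge> 2" using k by (simp add: m_def)
  \<comment> \<open>Here \<open>k >= 3\<close> enters: it makes \<open>y < 1\<close>, so that the
    power series converge.\<close>
  then have y: "0 < y" "y < 1" by (simp_all add: y_def)
  have my: "m * y = 1" using m by (simp add: y_def)
  have eq: "energy_coeff j * (real k - 1) powi (- int j) = energy_coeff j * y ^ j" for j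
    by (simp add: power_int_minus y_def m_def power_one_over field_simps)
  show pos: "energy_coeff j * (real k - 1) powi (- int j) > 0" for j
    unfolding eq using energy_coeff_pos y by simp
  have sums: "(\<lambda>j. energy_coeff j * (real k - 1) powi (- int j)) sums (G / y ^ 2 - G)"
    unfolding eq unfolding energy_coeff_eq G_def using y by (rule path_energy_difference_sums)
  then show summ: "summable (\<lambda>j. energy_coeff j * (real k - 1) powi (- int j))"
    by (rule sums_summable)
  show cpos: "energy_const k > 0"
    unfolding energy_const_def by (rule suminf_pos[OF summ pos])
  have "energy_const k = G / y ^ 2 - G"
    unfolding energy_const_def using sums by (rule sums_unique[symmetric])
  \<comment> \<open>With \<open>m = 1 / y\<close> this is \<open>m^2 - 1 = (m + 1) (m - 1)\<close>
    times \<open>G\<close>, and \<open>m + 1 = k\<close>. It identifies the series with steps of two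
    in the statement with the series with steps of one in the energy formula.\<close>
  also have "\<dots> = real k * (G / y - G)"
    using m by (simp add: y_def m_def power2_eq_square field_simps)
  finally have const: "energy_const k = real k * (G / y - G)" .
  have "(\<lambda>l. \<Sum>h<l. ?d h * y ^ h) \<longlonglongrightarrow> G / y - G"
    using path_energy_difference_sums(1)[OF y] unfolding sums_def G_def .
  from tendsto_mult_left[OF this, of "real k"]
  have main: "(\<lambda>l. \<Sum>h<l. real k * y ^ h * ?d h) \<longlonglongrightarrow> energy_const k"
    unfolding const by (simp add: sum_distrib_left mult_ac)
  \<comment> \<open>The boundary term is \<open>m\<close> times the general term of the convergent
    series \<open>G\<close>.\<close>
  have "(\<lambda>l. path_energy l * y ^ l) \<longlonglongrightarrow> 0"
    using y by (intro summable_LIMSEQ_zero summable_path_energy) auto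
  from tendsto_mult_left_zero[OF this, of m]
  have "(\<lambda>l. path_energy l * y ^ l * m) \<longlonglongrightarrow> 0" .
  moreover have "path_energy l * y ^ l * m = path_energy l * y ^ (l - 1)" if "l \<ge> 1" for l
    using my that by (cases l) (simp_all add: mult_ac)
  then have "\<forall>\<^sub>F l in at_top. path_energy l * y ^ l * m = path_energy l * y ^ (l - 1)"
    by (rule eventually_mono[OF eventually_ge_at_top[of 1]])
  ultimately have last: "(\<lambda>l. path_energy l * y ^ (l - 1)) \<longlonglongrightarrow> 0"
    by (rule Lim_transform_eventually)
  \<comment> \<open>These are the terms of the differentiated geometric series; they dominate the
    root contribution, since \<open>root_poly\<close> has \<open>l + 1\<close> roots of modulus at
    most \<open>k\<close>.\<close>
  have "(\<lambda>l. of_nat (Suc l) * y ^ l) \<longlonglongrightarrow> 0"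
    using y by (intro summable_LIMSEQ_zero sums_summable[OF geometric_deriv_sums]) simp
  from tendsto_mult_left_zero[OF this, of "real k * sqrt m"]
  have bd: "(\<lambda>l. of_nat (Suc l) * y ^ l * (real k * sqrt m)) \<longlonglongrightarrow> 0" .
  have root: "(\<lambda>l. poly_energy (root_poly (k - 1) l) * sqrt m * y ^ l) \<longlonglongrightarrow> 0"
  proof (rule tendsto_sandwich[OF _ _ tendsto_const bd]; intro always_eventually allI)
    fix l
    show "0 \<le> poly_energy (root_poly (k - 1) l) * sqrt m * y ^ l"
      using m y by (intro mult_nonneg_nonneg poly_energy_nonneg) auto
    have "poly_energy (root_poly (k - 1) l) * sqrt m * y ^ l \<le> (real (Suc l) * real k) * sqrt m * y ^ l"
      using m y k root_poly_energy_le[of k l] by (intro mult_right_mono) auto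
    then show "poly_energy (root_poly (k - 1) l) * sqrt m * y ^ l \<le>
        of_nat (Suc l) * y ^ l * (real k * sqrt m)"
      by (simp only: mult_ac)
  qed
  have "(\<lambda>l. poly_energy (root_poly (k - 1) l) * sqrt m * y ^ l +
      (\<Sum>h<l. real k * y ^ h * ?d h) - path_energy l * y ^ (l - 1)) \<longlonglongrightarrow> 0 + energy_const k - 0"
    by (intro tendsto_diff tendsto_add root main last)
  moreover have "\<forall>\<^sub>F l in at_top. poly_energy (root_poly (k - 1) l) * sqrt m * y ^ l +
      (\<Sum>h<l. real k * y ^ h * ?d h) - path_energy l * y ^ (l - 1) =
      graph_energy (dendrimer l k) / m powr (real l - 1 / 2)"
    using eventually_ge_at_top[of 1]
  proof (rule eventually_mono)
    fix l :: nat assume "1 \<le> l"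
    then show "poly_energy (root_poly (k - 1) l) * sqrt m * y ^ l +
        (\<Sum>h<l. real k * y ^ h * ?d h) - path_energy l * y ^ (l - 1) =
        graph_energy (dendrimer l k) / m powr (real l - 1 / 2)"
      unfolding m_def y_def using k by (intro energy_dendrimer_ratio[symmetric]) auto
  qed
  ultimately have "(\<lambda>l. graph_energy (dendrimer l k) / m powr (real l - 1 / 2)) \<longlonglongrightarrow>
      0 + energy_const k - 0"
    by (rule Lim_transform_eventually)
  then have "(\<lambda>l. graph_energy (dendrimer l k) / m powr (real l - 1 / 2)) \<longlonglongrightarrow> energy_const k"
    by simp
  from tendsto_divide[OF this tendsto_const[of "energy_const k"]] cpos
  show "(\<lambda>l. graph_energy (dendrimer l k))
      \<sim>[at_top] (\<lambda>l. energy_const k * (real k - 1) powr (real l - 1 / 2))"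
    by (intro asymp_equivI') (simp add: mult.commute m_def)
qed

theorem theorem1:
  shows "(\<forall>l::nat. l \<ge> 1 \<longrightarrow>
            (\<lambda>k. graph_energy (dendrimer l k))
              \<sim>[at_top] (\<lambda>k. 2 * (real k - 1) powr (real l - 1 / 2))) \<and>
         (\<forall>k::nat. k \<ge> 3 \<longrightarrow>
            (\<forall>j. energy_coeff j * (real k - 1) powi (- int j) > 0) \<and>
            summable (\<lambda>j. energy_coeff j * (real k - 1) powi (- int j)) \<and>
            energy_const k > 0 \<and>
            (\<lambda>l. graph_energy (dendrimer l k))
              \<sim>[at_top] (\<lambda>l. energy_const k * (real k - 1) powr (real l - 1 / 2)))"
  by (intro conjI allI impI energy_asymp_degree energy_series_pos energy_series_summable
      energy_const_pos energy_asymp_levels)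

end
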